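(* Assume $X$ is a compact Hausdorff topological space with a finite Borel measure $\mu$ such that every nonempty open set has strictly positive measure, and let $(\phi,g)$ be an admissible pair, with $C=\mathrm{Cone}(\phi(X))\subseteq V$. Suppose that $(\mathcal{F}_j)_{j\in\mathbb{N}}$ is an increasing sequence of vector subspaces of the algebra of continuous real-valued functions on $X$ with the uniform norm. If $\bigcup_{j=1}^{\infty}\mathcal{F}_j$ is a subalgebra which separates points and contains the constant functions, then $$\bigcap_{j=1}^{\infty} C^*(\mathcal{F}_j)=C^*\qquad\text{and}\qquad \overline{\bigcup_{j=1}^{\infty} C(\mathcal{F}_j)}=C.$$
   Context: $V$ is a real finite-dimensional vector space. A pair $(\phi,g)$, with $\phi:X\to V$ continuous and $g:V\to\mathbb{R}$ linear, is called admissible if the affine hull of $\phi(X)$ equals $g^{-1}(1)$. $\mathrm{Cone}(\phi(X))$ is the convex cone generated by $\phi(X)$. For a cone $D\subseteq V$ the dual cone is $D^*=\{\ell\in V^*:\ell(d)\ge 0\ \forall d\in D\}$ (similarly for cones in $V^*$, with $V^{**}=V$). For a vector space $\mathcal{F}$ of continuous real-valued functions on $X$ and $\lambda\in V^*$, let $Q_\lambda$ be the symmetric bilinear form on $\mathcal{F}$ given by $Q_\lambda(p,q)=\int_X\lambda(\phi(u))p(u)q(u)\,d\mu(u)$. Define $C^*(\mathcal{F})=\{\lambda\in V^*: Q_\lambda \text{ is positive semidefinite on }\mathcal{F}\}$ and $C(\mathcal{F})=C^*(\mathcal{F})^*\subseteq V$. The closure is taken in $V$. *)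

theory Defs
  imports "HOL-Analysis.Analysis"
begin

text \<open>
  Conventions. A finite-dimensional real vector space \<open>V\<close> is a type of class
  \<open>euclidean_space\<close>, and \<open>V\<^sup>*\<close> is \<open>'v \<Rightarrow>\<^sub>L real\<close>: in finite dimension every linear functional
  is bounded. The space \<open>X\<close> is a whole type, compactness being an assumption on \<open>UNIV\<close>;
  the algebra of continuous functions on a compact \<open>X\<close> with the uniform norm is then
  \<open>'x \<Rightarrow>\<^sub>C real\<close>, since boundedness is automatic.
\<close>

definition admissible ::
  "('x::topological_space \<Rightarrow> 'v::euclidean_space) \<Rightarrow> ('v \<Rightarrow> real) \<Rightarrow> bool"
  where "admissible \<phi> g \<longleftrightarrow>
    continuous_on UNIV \<phi> \<and> linear g \<and> affine hull (range \<phi>) = g -` {1}"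

definition dual_cone :: "'v::euclidean_space set \<Rightarrow> ('v \<Rightarrow>\<^sub>L real) set"
  where "dual_cone D = {l. \<forall>d\<in>D. 0 \<le> blinfun_apply l d}"

text \<open>The dual of a cone in \<open>V\<^sup>*\<close>, as a subset of \<open>V\<close> via the evaluation isomorphism \<open>V\<^sup>*\<^sup>* = V\<close>.\<close>

definition predual_cone :: "('v::euclidean_space \<Rightarrow>\<^sub>L real) set \<Rightarrow> 'v set"
  where "predual_cone E = {v. \<forall>l\<in>E. 0 \<le> blinfun_apply l v}"

definition Q_form ::
  "'x::topological_space measure \<Rightarrow> ('x \<Rightarrow> 'v::euclidean_space) \<Rightarrow> ('v \<Rightarrow>\<^sub>L real) \<Rightarrow>
    ('x \<Rightarrow>\<^sub>C real) \<Rightarrow> ('x \<Rightarrow>\<^sub>C real) \<Rightarrow> real"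
  where "Q_form \<mu> \<phi> l p q =
    (\<integral>u. blinfun_apply l (\<phi> u) * apply_bcontfun p u * apply_bcontfun q u \<partial>\<mu>)"

definition psd_on :: "'f set \<Rightarrow> ('f \<Rightarrow> 'f \<Rightarrow> real) \<Rightarrow> bool"
  where "psd_on F B \<longleftrightarrow> (\<forall>p\<in>F. 0 \<le> B p p)"

definition C_star ::
  "'x::topological_space measure \<Rightarrow> ('x \<Rightarrow> 'v::euclidean_space) \<Rightarrow> ('x \<Rightarrow>\<^sub>C real) set \<Rightarrow>
    ('v \<Rightarrow>\<^sub>L real) set"
  where "C_star \<mu> \<phi> F = {l. psd_on F (Q_form \<mu> \<phi> l)}"

definition C_cone ::
  "'x::topological_space measure \<Rightarrow> ('x \<Rightarrow> 'v::euclidean_space) \<Rightarrow> ('x \<Rightarrow>\<^sub>C real) set \<Rightarrow> 'v set"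
  where "C_cone \<mu> \<phi> F = predual_cone (C_star \<mu> \<phi> F)"

text \<open>The library has no multiplication on \<open>'x \<Rightarrow>\<^sub>C real\<close>, so closure under pointwise
  products is spelled out.\<close>

definition subalgebra_C :: "('x::topological_space \<Rightarrow>\<^sub>C real) set \<Rightarrow> bool"
  where "subalgebra_C A \<longleftrightarrow> subspace A \<and>
    (\<forall>p\<in>A. \<forall>q\<in>A. \<exists>r\<in>A. \<forall>x. apply_bcontfun r x = apply_bcontfun p x * apply_bcontfun q x)"

definition separates_points :: "('x::topological_space \<Rightarrow>\<^sub>C real) set \<Rightarrow> bool"
  where "separates_points A \<longleftrightarrow>
    (\<forall>x y. x \<noteq> y \<longrightarrow> (\<exists>p\<in>A. apply_bcontfun p x \<noteq> apply_bcontfun p y))"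

end

theory Submission
  imports Defs
begin

text \<open>
  Both equalities say that positivity tested against the squares \<open>p\<^sup>2\<close> with
  \<open>p \<in> A = (\<Union>j. F j)\<close> is the same as pointwise positivity.

  \<^item> If \<open>\<integral> f p\<^sup>2 d\<mu> \<ge> 0\<close> for all \<open>p\<close> in a subset of the continuous functions that is
    uniformly dense, then the same holds for all continuous \<open>p\<close>
    (\<open>integral_squares_nonneg_dense\<close>). The choice \<open>p = max 0 (- f)\<close> makes the integrand \<open>- p\<^sup>3\<close>,
    so \<open>p\<close> vanishes almost everywhere, hence everywhere, because \<open>\<mu>\<close> charges nonempty open
    sets; thus \<open>f \<ge> 0\<close> (\<open>nonneg_if_integral_squares_nonneg\<close>). The algebra \<open>A\<close> is dense by
    Stone--Weierstrass, and with \<open>f = \<lambda> \<circ> \<phi>\<close> this identifies \<open>\<Inter>j. C\<^sup>*(F j)\<close> with the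
    functionals that are nonnegative on \<open>\<phi>(X)\<close>, that is, with \<open>C\<^sup>*\<close>.

  \<^item> The form \<open>Q_\<lambda>(p,p)\<close> is the value of \<open>\<lambda>\<close> at the vector \<open>w p = \<integral> p\<^sup>2 \<phi> d\<mu>\<close>
    (\<open>Q_form_diag\<close>), so \<open>C\<^sup>*(F)\<close> consists of the \<open>\<lambda>\<close> nonnegative on these vectors, and
    \<open>w p \<in> C(F)\<close> for \<open>p \<in> F\<close>. Let \<open>K\<close> be the closure of \<open>\<Union>j. C(F j)\<close>. A functional
    nonnegative on \<open>K\<close> is nonnegative on all \<open>w p\<close> with \<open>p \<in> A\<close>, so it lies in
    \<open>\<Inter>j. C\<^sup>*(F j) = C\<^sup>*\<close>; this gives \<open>C \<subseteq> K\<^sup>*\<^sup>* = K\<close> by the bipolar theorem for closed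
    convex cones (\<open>predual_dual_cone\<close>). Conversely \<open>C\<^sup>* \<subseteq> C\<^sup>*(F j)\<close> gives
    \<open>C(F j) \<subseteq> C\<^sup>*\<^sup>* = C\<close>. Here \<open>C\<close> is closed since the compact set \<open>\<phi>(X)\<close> lies in
    the affine hyperplane \<open>g = 1\<close>, which misses the origin (\<open>closed_convex_cone_hull_compact\<close>).
\<close>

section \<open>Closed convex cones and their duals\<close>

lemma convex_cone_predual: "convex_cone (predual_cone E)"
  by (auto simp: convex_cone_iff predual_cone_def blinfun.bilinear_simps)

lemma closed_predual: "closed (predual_cone E)"
proof -
  have "predual_cone E = (\<Inter>l\<in>E. {v. 0 \<le> blinfun_apply l v})"
    by (auto simp: predual_cone_def)
  then show ?thesis
    by (auto intro!: closed_INT closed_Collect_le continuous_intros)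
qed

lemma predual_antimono: "E \<subseteq> E' \<Longrightarrow> predual_cone E' \<subseteq> predual_cone E"
  by (auto simp: predual_cone_def)

text \<open>The bipolar theorem: a point outside a closed convex cone is separated from it by an affine
  hyperplane, and invariance of the cone under scaling allows this hyperplane to pass through
  the origin.\<close>

lemma predual_dual_cone:
  fixes K :: "'v::euclidean_space set"
  assumes "convex_cone K" "closed K"
  shows "predual_cone (dual_cone K) = K"
proof
  show "K \<subseteq> predual_cone (dual_cone K)"
    by (auto simp: predual_cone_def dual_cone_def)
next
  show "predual_cone (dual_cone K) \<subseteq> K"
  proof (rule ccontr)
    assume "\<not> ?thesis"
    then obtain z where z: "z \<in> predual_cone (dual_cone K)" "z \<notin> K"
      by auto
    have "convex K"
      using assms by (simp add: convex_cone_def)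
    then obtain a b where ab: "a \<bullet> z < b" "\<And>x. x \<in> K \<Longrightarrow> b < a \<bullet> x"
      using separating_hyperplane_closed_point[of K z] assms z by auto
    have "b < 0"
      using ab(2)[of 0] convex_cone_contains_0[OF assms(1)] by simp
    have "0 \<le> a \<bullet> x" if "x \<in> K" for x
    proof (rule ccontr)
      assume neg: "\<not> 0 \<le> a \<bullet> x"
      \<comment> \<open>The multiple of \<open>x\<close> that lies exactly on the separating hyperplane.\<close>
      define c where "c = b / (a \<bullet> x)"
      have "c *\<^sub>R x \<in> K"
        using neg \<open>b < 0\<close> that
        by (intro convex_cone_scaleR[OF assms(1)]) (auto simp: c_def divide_nonpos_neg)
      then have "b < a \<bullet> (c *\<^sub>R x)"
        by (rule ab(2))
      then show False
        using neg by (simp add: c_def)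
    qed
    then have "blinfun_inner_right a \<in> dual_cone K"
      by (simp add: dual_cone_def)
    then have "0 \<le> a \<bullet> z"
      using z(1) by (auto simp: predual_cone_def)
    then show False
      using ab(1) \<open>b < 0\<close> by simp
  qed
qed

lemma dual_cone_hull:
  "dual_cone (convex_cone hull S) = {l. \<forall>s\<in>S. 0 \<le> blinfun_apply l s}"
proof (intro equalityI subsetI)
  fix l assume "l \<in> dual_cone (convex_cone hull S)"
  then show "l \<in> {l. \<forall>s\<in>S. 0 \<le> blinfun_apply l s}"
    by (auto simp: dual_cone_def hull_inc)
next
  fix l :: "'a \<Rightarrow>\<^sub>L real"
  assume "l \<in> {l. \<forall>s\<in>S. 0 \<le> blinfun_apply l s}"
  then have "convex_cone hull S \<subseteq> predual_cone {l}"
    by (intro hull_minimal convex_cone_predual) (auto simp: predual_cone_def)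
  then show "l \<in> dual_cone (convex_cone hull S)"
    by (auto simp: dual_cone_def predual_cone_def)
qed

text \<open>The hyperplane \<open>g = 1\<close> keeps the compact set \<open>convex hull S\<close> away from the origin. A
  disc with the origin on its boundary circle generates a cone that is not closed.\<close>

lemma closed_convex_cone_hull_compact:
  fixes S :: "'v::euclidean_space set"
  assumes "compact S" "S \<noteq> {}" "linear g" "\<And>s. s \<in> S \<Longrightarrow> g s = (1::real)"
  shows "closed (convex_cone hull S)"
proof -
  have "convex (g -` {1})"
    using assms(3) by (intro convex_linear_vimage) auto
  then have "convex hull S \<subseteq> g -` {1}"
    using assms(4) by (intro hull_minimal) auto
  then have "0 \<notin> convex hull S"
    using linear_0[OF assms(3)] by auto
  then have "closed (conic hull (convex hull S))"
    using assms(1) by (intro closed_conic_hull disjI2 conjI compact_convex_hull)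
  then show ?thesis
    using assms(2) by (simp add: convex_cone_hull_separate_nonempty)
qed

lemma convex_cone_closure:
  fixes K :: "'v::euclidean_space set"
  assumes "convex_cone K"
  shows "convex_cone (closure K)"
  using assms by (auto simp: convex_cone_def conic_closure)

lemma convex_cone_increasing_Union:
  fixes K :: "nat \<Rightarrow> 'v::euclidean_space set"
  assumes "mono_on {1..} K" "\<And>j. 1 \<le> j \<Longrightarrow> convex_cone (K j)"
  shows "convex_cone (\<Union>j\<in>{1..}. K j)"
  unfolding convex_cone_iff
proof (intro conjI ballI allI impI)
  show "0 \<in> (\<Union>j\<in>{1..}. K j)"
    using assms(2)[of 1] convex_cone_contains_0 by auto
next
  fix x y assume "x \<in> (\<Union>j\<in>{1..}. K j)" "y \<in> (\<Union>j\<in>{1..}. K j)"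
  then obtain i j where ij: "1 \<le> i" "1 \<le> j" "x \<in> K i" "y \<in> K j"
    by auto
  then have "K i \<subseteq> K (max i j)" "K j \<subseteq> K (max i j)"
    by (simp_all add: mono_onD[OF assms(1)])
  then have "x + y \<in> K (max i j)"
    using ij assms(2)[of "max i j"] by (intro convex_cone_add) auto
  then show "x + y \<in> (\<Union>j\<in>{1..}. K j)"
    using ij by (intro UN_I[of "max i j"]) auto
next
  fix x and c :: real
  assume "x \<in> (\<Union>j\<in>{1..}. K j)" "0 \<le> c"
  then show "c *\<^sub>R x \<in> (\<Union>j\<in>{1..}. K j)"
    using assms(2) convex_cone_scaleR by (metis UN_iff atLeast_iff)
qed

section \<open>Density of the subalgebra\<close>

text \<open>The Stone--Weierstrass theorem, translated from a set of functions to a set of elements of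
  the space of bounded continuous functions.\<close>

lemma subalgebra_C_uniformly_dense:
  fixes A :: "('x::t2_space \<Rightarrow>\<^sub>C real) set"
  assumes "compact (UNIV :: 'x set)" "subalgebra_C A" "separates_points A"
    and const: "\<And>c. const_bcontfun c \<in> A"
    and h: "continuous_on UNIV h"
  obtains p where "\<And>n. p n \<in> A"
    "uniform_limit UNIV (\<lambda>n. apply_bcontfun (p n)) h sequentially"
proof -
  have sub: "subspace A"
    using assms(2) by (simp add: subalgebra_C_def)
  interpret R: function_ring_on "apply_bcontfun ` A" UNIV
  proof
    fix f g :: "'x \<Rightarrow> real"
    assume "f \<in> apply_bcontfun ` A" "g \<in> apply_bcontfun ` A"
    then obtain p q where pq: "p \<in> A" "q \<in> A" "f = apply_bcontfun p" "g = apply_bcontfun q"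
      by auto
    show "(\<lambda>x. f x + g x) \<in> apply_bcontfun ` A"
      using subspace_add[OF sub pq(1,2)] by (intro image_eqI[of _ _ "p + q"]) (auto simp: pq)
    obtain r where "r \<in> A" "\<And>x. apply_bcontfun r x = f x * g x"
      using assms(2) pq unfolding subalgebra_C_def by blast
    then show "(\<lambda>x. f x * g x) \<in> apply_bcontfun ` A"
      by (intro image_eqI[of _ _ r]) auto
  next
    fix c :: real
    show "(\<lambda>_. c) \<in> apply_bcontfun ` A"
      by (intro image_eqI[OF _ const[of c]]) auto
  next
    fix x y :: 'x
    assume "x \<noteq> y"
    then show "\<exists>f\<in>apply_bcontfun ` A. f x \<noteq> f y"
      using assms(3) by (auto simp: separates_points_def)
  qed (use assms(1) in auto)
  obtain G where G: "G \<in> UNIV \<rightarrow> apply_bcontfun ` A" "uniform_limit UNIV G h sequentially"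
    using R.Stone_Weierstrass[OF h] by blast
  from G(1) have "\<forall>n. \<exists>p\<in>A. G n = apply_bcontfun p"
    by blast
  then obtain p where p: "\<And>n. p n \<in> A" "\<And>n. G n = apply_bcontfun (p n)"
    by metis
  have "uniform_limit UNIV (\<lambda>n. apply_bcontfun (p n)) h sequentially"
    using G(2) p(2) by (simp flip: p(2))
  then show thesis
    using p(1) that by blast
qed

section \<open>Integrating against squares of continuous functions\<close>

context
  fixes \<mu> :: "'x::t2_space measure"
  assumes compact_X: "compact (UNIV :: 'x set)"
    and sets_\<mu>: "sets \<mu> = sets borel"
    and finite_\<mu>: "finite_measure \<mu>"
begin

lemma continuous_imp_bounded:
  fixes f :: "'x \<Rightarrow> 'b::real_normed_vector"
  assumes "continuous_on UNIV f"
  obtains M where "0 \<le> M" "\<And>x. norm (f x) \<le> M"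
proof -
  have "bounded (range f)"
    using compact_continuous_image[OF assms compact_X] by (rule compact_imp_bounded)
  then obtain M where "\<And>x. norm (f x) \<le> M"
    by (auto simp: bounded_iff)
  moreover from this have "0 \<le> M"
    using norm_ge_zero order_trans by blast
  ultimately show thesis
    using that by blast
qed

lemma continuous_imp_measurable:
  "continuous_on UNIV f \<Longrightarrow> f \<in> borel_measurable \<mu>"
  by (simp add: borel_measurable_continuous_onI measurable_cong_sets[OF sets_\<mu> refl])

lemma continuous_imp_integrable:
  fixes f :: "'x \<Rightarrow> 'b::{banach, second_countable_topology}"
  assumes "continuous_on UNIV f"
  shows "integrable \<mu> f"
proof -
  obtain M where "\<And>x. norm (f x) \<le> M"
    using continuous_imp_bounded[OF assms] by blast
  then show ?thesis
    using finite_measure.integrable_const_bound[OF finite_\<mu>, of f M]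
      continuous_imp_measurable[OF assms] by simp
qed

text \<open>Uniformly convergent \<open>p n\<close> are uniformly bounded, so \<open>f (p n)\<^sup>2\<close> is dominated by a constant
  and the integrals converge.\<close>

lemma integral_squares_nonneg_dense:
  fixes f h :: "'x \<Rightarrow> real"
  assumes f: "continuous_on UNIV f" and h: "continuous_on UNIV h"
    and p: "\<And>n. continuous_on UNIV (p n)"
    and lim: "uniform_limit UNIV p h sequentially"
    and nonneg: "\<And>n::nat. 0 \<le> (\<integral>u. f u * (p n u)\<^sup>2 \<partial>\<mu>)"
  shows "0 \<le> (\<integral>u. f u * (h u)\<^sup>2 \<partial>\<mu>)"
proof -
  obtain M where M: "0 \<le> M" "\<And>x. norm (f x) \<le> M"
    using continuous_imp_bounded[OF f] by blast
  obtain N where N: "0 \<le> N" "\<And>x. norm (h x) \<le> N"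
    using continuous_imp_bounded[OF h] by blast
  have "\<forall>\<^sub>F n in sequentially. \<forall>x\<in>UNIV. dist (p n x) (h x) < 1"
    using lim by (rule uniform_limitD) simp
  then obtain n0 where n0: "\<And>n x. n0 \<le> n \<Longrightarrow> dist (p n x) (h x) < 1"
    by (auto simp: eventually_sequentially)
  define q where "q n = p (n + n0)" for n
  have q_lim: "(\<lambda>n. q n x) \<longlonglongrightarrow> h x" for x
    unfolding q_def using tendsto_uniform_limitI[OF lim, of x]
    by (intro LIMSEQ_ignore_initial_segment) auto
  have "(\<lambda>n. \<integral>u. f u * (q n u)\<^sup>2 \<partial>\<mu>) \<longlonglongrightarrow> (\<integral>u. f u * (h u)\<^sup>2 \<partial>\<mu>)"
  proof (rule integral_dominated_convergence[where w = "\<lambda>_. M * (N + 1)\<^sup>2"])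
    show "(\<lambda>u. f u * (h u)\<^sup>2) \<in> borel_measurable \<mu>"
      by (intro continuous_imp_measurable continuous_intros f h)
    show "(\<lambda>u. f u * (q n u)\<^sup>2) \<in> borel_measurable \<mu>" for n
      unfolding q_def by (intro continuous_imp_measurable continuous_intros f p)
    show "integrable \<mu> (\<lambda>_. M * (N + 1)\<^sup>2)"
      by (intro continuous_imp_integrable continuous_intros)
    show "AE u in \<mu>. (\<lambda>n. f u * (q n u)\<^sup>2) \<longlonglongrightarrow> f u * (h u)\<^sup>2"
      by (intro AE_I2 tendsto_intros q_lim)
    show "AE u in \<mu>. norm (f u * (q n u)\<^sup>2) \<le> M * (N + 1)\<^sup>2" for n
    proof (rule AE_I2)
      fix u
      have "\<bar>q n u\<bar> \<le> N + 1"
        using n0[of "n + n0" u] N(2)[of u] by (auto simp: q_def dist_real_def)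
      then have "(q n u)\<^sup>2 \<le> (N + 1)\<^sup>2"
        using abs_le_square_iff[of "q n u" "N + 1"] N(1) by simp
      then show "norm (f u * (q n u)\<^sup>2) \<le> M * (N + 1)\<^sup>2"
        using M(1) M(2)[of u] by (auto simp: abs_mult intro!: mult_mono)
    qed
  qed
  then show ?thesis
    by (rule LIMSEQ_le_const) (auto simp: q_def nonneg)
qed

text \<open>The test function is the negative part \<open>h\<close> of \<open>f\<close>, for which \<open>f h\<^sup>2 = - h\<^sup>3\<close>.\<close>

lemma nonneg_if_integral_squares_nonneg:
  fixes f :: "'x \<Rightarrow> real"
  assumes pos: "\<And>U. open U \<Longrightarrow> U \<noteq> {} \<Longrightarrow> 0 < emeasure \<mu> U"
    and f: "continuous_on UNIV f"
    and nonneg: "\<And>h. continuous_on UNIV h \<Longrightarrow> 0 \<le> (\<integral>u. f u * (h u)\<^sup>2 \<partial>\<mu>)"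
  shows "0 \<le> f x"
proof -
  define h where "h u = max 0 (- f u)" for u
  have h: "continuous_on UNIV h"
    unfolding h_def by (intro continuous_intros f)
  have h_nonneg: "0 \<le> h u" for u
    by (simp add: h_def)
  have "f u * (h u)\<^sup>2 = - (h u ^ 3)" for u
    by (simp add: h_def max_def power2_eq_square power3_eq_cube)
  then have "0 \<le> - (\<integral>u. h u ^ 3 \<partial>\<mu>)"
    using nonneg[OF h] by simp
  moreover have "0 \<le> (\<integral>u. h u ^ 3 \<partial>\<mu>)"
    by (simp add: h_nonneg)
  ultimately have "(\<integral>u. h u ^ 3 \<partial>\<mu>) = 0"
    by simp
  moreover have "integrable \<mu> (\<lambda>u. h u ^ 3)"
    by (intro continuous_imp_integrable continuous_intros h)
  ultimately have "AE u in \<mu>. h u ^ 3 = 0"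
    using h_nonneg by (subst (asm) integral_nonneg_eq_0_iff_AE) auto
  then have ae: "AE u in \<mu>. u \<notin> {u. 0 < h u}"
    by eventually_elim auto
  have op: "open {u. 0 < h u}"
    by (intro open_Collect_less continuous_intros h)
  have "space \<mu> = UNIV"
    using sets_eq_imp_space_eq[OF sets_\<mu>] by simp
  then have "emeasure \<mu> {u. 0 < h u} = 0"
    using ae op by (subst (asm) AE_iff_measurable[OF _ refl]) (auto simp: sets_\<mu>)
  then have "{u. 0 < h u} = {}"
    using pos[OF op] by fastforce
  then have "h x = 0"
    using h_nonneg[of x] by (metis empty_Collect_eq less_eq_real_def)
  then show ?thesis
    by (simp add: h_def max_def split: if_splits)
qed

text \<open>The diagonal of \<open>Q_form\<close> is evaluation at a vector of \<open>V\<close>, a vector-valued integral. This is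
  what makes \<open>C_star \<mu> \<phi> F\<close> the dual of a subset of \<open>V\<close>.\<close>

lemma Q_form_diag:
  fixes \<phi> :: "'x \<Rightarrow> 'v::euclidean_space"
  assumes "continuous_on UNIV \<phi>"
  shows "Q_form \<mu> \<phi> l p p = blinfun_apply l (\<integral>u. (apply_bcontfun p u)\<^sup>2 *\<^sub>R \<phi> u \<partial>\<mu>)"
proof -
  have "integrable \<mu> (\<lambda>u. (apply_bcontfun p u)\<^sup>2 *\<^sub>R \<phi> u)"
    by (intro continuous_imp_integrable continuous_intros assms) auto
  then have "blinfun_apply l (\<integral>u. (apply_bcontfun p u)\<^sup>2 *\<^sub>R \<phi> u \<partial>\<mu>)
    = (\<integral>u. blinfun_apply l ((apply_bcontfun p u)\<^sup>2 *\<^sub>R \<phi> u) \<partial>\<mu>)"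
    by (simp add: integral_bounded_linear[OF blinfun.bounded_linear_right])
  then show ?thesis
    by (simp add: Q_form_def blinfun.scaleR_right power2_eq_square ac_simps)
qed

end

section \<open>The cones of the filtration\<close>

lemma Q_form_square:
  "Q_form \<mu> \<phi> l p p = (\<integral>u. blinfun_apply l (\<phi> u) * (apply_bcontfun p u)\<^sup>2 \<partial>\<mu>)"
  by (simp add: Q_form_def power2_eq_square mult.assoc)

lemma C_star_antimono: "F \<subseteq> G \<Longrightarrow> C_star \<mu> \<phi> G \<subseteq> C_star \<mu> \<phi> F"
  by (auto simp: C_star_def psd_on_def)

theorem theorem1p2:
  fixes \<mu> :: "'x::t2_space measure"
    and \<phi> :: "'x \<Rightarrow> 'v::euclidean_space"
    and g :: "'v \<Rightarrow> real"
    and F :: "nat \<Rightarrow> ('x \<Rightarrow>\<^sub>C real) set"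
    and C :: "'v set"
  defines "C \<equiv> convex_cone hull (range \<phi>)"
  assumes "compact (UNIV :: 'x set)"
    and "sets \<mu> = sets borel"
    and "finite_measure \<mu>"
    and "\<And>U. open U \<Longrightarrow> U \<noteq> {} \<Longrightarrow> 0 < emeasure \<mu> U"
    and "admissible \<phi> g"
    and "\<And>j. 1 \<le> j \<Longrightarrow> subspace (F j)"
    and "mono_on {1..} F"
    and "subalgebra_C (\<Union>j\<in>{1..}. F j)"
    and "separates_points (\<Union>j\<in>{1..}. F j)"
    and "\<And>c. const_bcontfun c \<in> (\<Union>j\<in>{1..}. F j)"
  shows "(\<Inter>j\<in>{1..}. C_star \<mu> \<phi> (F j)) = dual_cone C
    \<and> closure (\<Union>j\<in>{1..}. C_cone \<mu> \<phi> (F j)) = C"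
proof
  have cont: "continuous_on UNIV \<phi>" and lin: "linear g"
    and aff: "affine hull (range \<phi>) = g -` {1}"
    using assms(6) by (auto simp: admissible_def)
  note X = assms(2-4)
  let ?A = "\<Union>j\<in>{1..}. F j"
  have dual_C: "dual_cone C = {l. \<forall>x. 0 \<le> blinfun_apply l (\<phi> x)}"
    by (simp add: C_def dual_cone_hull)
  show stars: "(\<Inter>j\<in>{1..}. C_star \<mu> \<phi> (F j)) = dual_cone C"
  proof (intro equalityI subsetI)
    fix l assume l: "l \<in> dual_cone C"
    have "0 \<le> Q_form \<mu> \<phi> l p p" for p
      using l by (simp add: Q_form_square dual_C)
    then show "l \<in> (\<Inter>j\<in>{1..}. C_star \<mu> \<phi> (F j))"
      by (simp add: C_star_def psd_on_def)
  next
    fix l assume l: "l \<in> (\<Inter>j\<in>{1..}. C_star \<mu> \<phi> (F j))"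
    have f: "continuous_on UNIV (\<lambda>u. blinfun_apply l (\<phi> u))"
      by (intro continuous_intros cont)
    have "0 \<le> (\<integral>u. blinfun_apply l (\<phi> u) * (h u)\<^sup>2 \<partial>\<mu>)" if h: "continuous_on UNIV h" for h
    proof -
      obtain p where p: "\<And>n. p n \<in> ?A"
        "uniform_limit UNIV (\<lambda>n. apply_bcontfun (p n)) h sequentially"
        using subalgebra_C_uniformly_dense[OF assms(2,9,10,11) h] by metis
      have "0 \<le> (\<integral>u. blinfun_apply l (\<phi> u) * (apply_bcontfun (p n) u)\<^sup>2 \<partial>\<mu>)" for n
        using l p(1)[of n] by (auto simp: C_star_def psd_on_def simp flip: Q_form_square)
      then show ?thesis
        using integral_squares_nonneg_dense[OF X f h _ p(2)] by auto
    qed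
    then show "l \<in> dual_cone C"
      using nonneg_if_integral_squares_nonneg[OF X assms(5) f] by (simp add: dual_C)
  qed
  let ?K = "closure (\<Union>j\<in>{1..}. C_cone \<mu> \<phi> (F j))"
  have cone_C: "convex_cone C"
    by (simp add: C_def convex_cone_convex_cone_hull)
  have "\<And>x. g (\<phi> x) = 1"
    using hull_subset[of "range \<phi>" affine] aff by auto
  then have closed_C: "closed C"
    unfolding C_def using compact_continuous_image[OF cont assms(2)] lin
    by (intro closed_convex_cone_hull_compact[where g = g]) auto
  have "mono_on {1..} (\<lambda>j. C_cone \<mu> \<phi> (F j))"
    unfolding C_cone_def
    by (intro mono_onI predual_antimono C_star_antimono mono_onD[OF assms(8)])
  then have cone_K: "convex_cone ?K"
    by (intro convex_cone_closure convex_cone_increasing_Union)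
      (simp_all add: C_cone_def convex_cone_predual)
  show "?K = C"
  proof
    have "C_cone \<mu> \<phi> (F j) \<subseteq> C" if "1 \<le> j" for j
    proof -
      have "C_cone \<mu> \<phi> (F j) \<subseteq> predual_cone (dual_cone C)"
        unfolding C_cone_def stars[symmetric] using that by (intro predual_antimono) auto
      then show ?thesis
        by (simp add: predual_dual_cone cone_C closed_C)
    qed
    then show "?K \<subseteq> C"
      by (intro closure_minimal closed_C) auto
  next
    have "dual_cone ?K \<subseteq> dual_cone C"
      unfolding stars[symmetric]
    proof (intro subsetI INT_I)
      fix l j assume l: "l \<in> dual_cone ?K" and j: "j \<in> {1::nat..}"
      have "0 \<le> Q_form \<mu> \<phi> l p p" if p: "p \<in> F j" for p
      proof -
        have "(\<integral>u. (apply_bcontfun p u)\<^sup>2 *\<^sub>R \<phi> u \<partial>\<mu>) \<in> C_cone \<mu> \<phi> (F j)"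
          using p by (auto simp: C_cone_def predual_cone_def C_star_def psd_on_def
              Q_form_diag[OF X cont])
        then have "(\<integral>u. (apply_bcontfun p u)\<^sup>2 *\<^sub>R \<phi> u \<partial>\<mu>) \<in> ?K"
          using j by (intro subsetD[OF closure_subset] UN_I[of j])
        then show ?thesis
          using l by (simp add: dual_cone_def Q_form_diag[OF X cont])
      qed
      then show "l \<in> C_star \<mu> \<phi> (F j)"
        by (simp add: C_star_def psd_on_def)
    qed
    then have "predual_cone (dual_cone C) \<subseteq> predual_cone (dual_cone ?K)"
      by (rule predual_antimono)
    then show "C \<subseteq> ?K"
      by (simp only: predual_dual_cone[OF cone_C closed_C]
          predual_dual_cone[OF cone_K closed_closure])
  qed
qed

end
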